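(* Let $(\mathbf M,\rhd)$ be a diagonal left-regular magma, let $(F_{\mathbf M},.)$ be the free group generated by $\mathbf M$, endowed with its unique post-group structure $(F_{\mathbf M},.,\rhd)$ whose product $\rhd$ extends the product $\rhd$ of $\mathbf M$, and let $*$ be the associated Grossman--Larson group law on $F_{\mathbf M}$. Then there is a unique group isomorphism $$\mathcal J:(F_{\mathbf M},.)\longrightarrow (F_{\mathbf M},* )$$ such that $\mathcal J|_{\mathbf M}=\mathrm{Id}_{\mathbf M}$.
   Context: A magma is a set $\mathbf M$ with a binary product $\rhd:\mathbf M\times\mathbf M\to\mathbf M$. It is left-regular if for every $m\in\mathbf M$ the left multiplication $L_m^\rhd=m\rhd -:\mathbf M\to\mathbf M$ is bijective. A left-regular magma is diagonal if moreover the map $\Lambda:\mathbf M\to\mathbf M$, $\Lambda(m)=(L_m^\rhd)^{-1}(m)$, is a bijection. A post-group $(G,.,\rhd)$ is a group $(G,.)$ endowed with a binary map $\rhd:G\times G\to G$ such that for every $a\in G$ the map $L_a^\rhd:=a\rhd -:G\to G$ is a group automorphism of $(G,.)$, and such that $(a*b)\rhd c=a\rhd(b\rhd c)$ for all $a,b,c\in G$, where $a*b:=a.(a\rhd b)$. In any post-group, $*$ is a second group law on $G$, with the same unit as $.$; the group $(G,* )$ is called the Grossman--Larson group of the post-group. Fact used to set up the statement: for a diagonal left-regular magma $\mathbf M$, there is a unique binary product $\rhd$ on the free group $F_{\mathbf M}$ extending the product of $\mathbf M$ and making $(F_{\mathbf M},.,\rhd)$ a post-group. *)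

theory Defs
  imports "HOL-Algebra.Group"
begin

section \<open>Magmas\<close>

locale magma =
  fixes M :: "'a set" and tri :: "'a \<Rightarrow> 'a \<Rightarrow> 'a"  (infixr "\<rhd>" 70)
  assumes tri_closed: "\<lbrakk>m \<in> M; n \<in> M\<rbrakk> \<Longrightarrow> m \<rhd> n \<in> M"

locale left_regular_magma = magma +
  assumes left_mult_bij: "m \<in> M \<Longrightarrow> bij_betw (\<lambda>n. m \<rhd> n) M M"
begin

definition Lam :: "'a \<Rightarrow> 'a"
  where "Lam m = inv_into M (\<lambda>n. m \<rhd> n) m"

end

locale diagonal_left_regular_magma = left_regular_magma +
  assumes Lam_bij: "bij_betw Lam M M"


section \<open>Post-groups\<close>

locale post_group = group G for G :: "('a, 'b) monoid_scheme" (structure) +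
  fixes tri :: "'a \<Rightarrow> 'a \<Rightarrow> 'a"  (infixr "\<rhd>" 75)
  assumes left_mult_aut: "a \<in> carrier G \<Longrightarrow> (\<lambda>b. a \<rhd> b) \<in> iso G G"
    and weighted_assoc:
      "\<lbrakk>a \<in> carrier G; b \<in> carrier G; c \<in> carrier G\<rbrakk> \<Longrightarrow>
        (a \<otimes> (a \<rhd> b)) \<rhd> c = a \<rhd> (b \<rhd> c)"

definition grossman_larson ::
    "('a, 'b) monoid_scheme \<Rightarrow> ('a \<Rightarrow> 'a \<Rightarrow> 'a) \<Rightarrow> ('a, 'b) monoid_scheme"
  where "grossman_larson G tri = G\<lparr>mult := (\<lambda>a b. a \<otimes>\<^bsub>G\<^esub> tri a b)\<rparr>"

lemma grossman_larson_simps [simp]: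
  "carrier (grossman_larson G tri) = carrier G"
  "one (grossman_larson G tri) = one G"
  "mult (grossman_larson G tri) a b = a \<otimes>\<^bsub>G\<^esub> tri a b"
  by (simp_all add: grossman_larson_def)

context post_group
begin

lemma tri_in_carrier [simp, intro]:
  "\<lbrakk>a \<in> carrier G; b \<in> carrier G\<rbrakk> \<Longrightarrow> a \<rhd> b \<in> carrier G"
  using left_mult_aut [of a] by (auto simp: iso_def hom_def)

lemma tri_mult:
  "\<lbrakk>a \<in> carrier G; b \<in> carrier G; c \<in> carrier G\<rbrakk> \<Longrightarrow> a \<rhd> (b \<otimes> c) = (a \<rhd> b) \<otimes> (a \<rhd> c)"
  using left_mult_aut [of a] by (auto simp: iso_def hom_def)

lemma tri_bij: "a \<in> carrier G \<Longrightarrow> bij_betw (\<lambda>b. a \<rhd> b) (carrier G) (carrier G)"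
  using left_mult_aut [of a] by (auto simp: iso_def)

lemma tri_one:
  assumes "a \<in> carrier G"
  shows "a \<rhd> \<one> = \<one>"
proof -
  have "(a \<rhd> \<one>) \<otimes> (a \<rhd> \<one>) = a \<rhd> \<one>"
    using tri_mult [of a \<one> \<one>] assms by simp
  then show ?thesis
    using assms by (metis l_cancel_one one_closed tri_in_carrier)
qed

lemma one_tri:
  assumes "b \<in> carrier G"
  shows "\<one> \<rhd> b = b"
proof -
  have "\<one> \<rhd> (\<one> \<rhd> b) = \<one> \<rhd> b"
    using weighted_assoc [of \<one> \<one> b] assms by (simp add: tri_one)
  then show ?thesis
    using tri_bij [of \<one>] assms by (auto simp: bij_betw_def dest!: inj_onD)
qed

lemma group_grossman_larson: "group (grossman_larson G (\<rhd>))" (is "group ?H")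
proof -
  have mon: "monoid ?H"
    by unfold_locales (auto simp: one_tri tri_one tri_mult weighted_assoc m_assoc)
  have right_inv: "\<exists>b\<in>carrier ?H. a \<otimes>\<^bsub>?H\<^esub> b = \<one>\<^bsub>?H\<^esub>" if "a \<in> carrier ?H" for a
  proof -
    obtain b where "b \<in> carrier G" "a \<rhd> b = inv a"
      using tri_bij [of a] \<open>a \<in> carrier ?H\<close> by (auto simp: bij_betw_def) (metis imageE inv_closed)
    then show ?thesis
      using that by (auto intro!: bexI [of _ b])
  qed
  interpret H: monoid ?H by (rule mon)
  show ?thesis
  proof (rule H.group_l_invI)
    fix a assume a: "a \<in> carrier ?H"
    obtain b where b: "b \<in> carrier ?H" "a \<otimes>\<^bsub>?H\<^esub> b = \<one>\<^bsub>?H\<^esub>"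
      using right_inv a by blast
    obtain c where c: "c \<in> carrier ?H" "b \<otimes>\<^bsub>?H\<^esub> c = \<one>\<^bsub>?H\<^esub>"
      using right_inv b by blast
    have "a = c"
      using a b c by (metis H.inv_unique)
    then show "\<exists>b\<in>carrier ?H. b \<otimes>\<^bsub>?H\<^esub> a = \<one>\<^bsub>?H\<^esub>"
      using b c by blast
  qed
qed

end


section \<open>Free groups\<close>

text \<open>
  The free group on a set is realised by reduced words: \<open>(False, a)\<close> is the
  generator \<open>a\<close> and \<open>(True, a)\<close> its inverse.  Folding \<open>push\<close> over the
  letters of \<open>u\<close> computes the reduced form of \<open>u @ v\<close>, provided \<open>v\<close> is reduced.
  The universal property is \<open>free_group_universal\<close> below.
\<close>

definition inv_letter :: "bool \<times> 'a \<Rightarrow> bool \<times> 'a"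
  where "inv_letter = map_prod Not id"

definition reduced :: "(bool \<times> 'a) list \<Rightarrow> bool"
  where "reduced = successively (\<lambda>x y. y \<noteq> inv_letter x)"

fun push :: "bool \<times> 'a \<Rightarrow> (bool \<times> 'a) list \<Rightarrow> (bool \<times> 'a) list" where
  "push x [] = [x]"
| "push x (y # w) = (if y = inv_letter x then w else x # y # w)"

definition free_group :: "'a set \<Rightarrow> (bool \<times> 'a) list monoid"
  where "free_group M =
    \<lparr>carrier = {w. reduced w \<and> set w \<subseteq> UNIV \<times> M}, mult = foldr push, one = []\<rparr>"

definition gen :: "'a \<Rightarrow> (bool \<times> 'a) list"
  where "gen a = [(False, a)]"

lemma free_group_simps [simp]:
  "carrier (free_group M) = {w. reduced w \<and> set w \<subseteq> UNIV \<times> M}"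
  "mult (free_group M) = foldr push"
  "one (free_group M) = []"
  by (simp_all add: free_group_def)

lemma inv_letter_inv_letter [simp]: "inv_letter (inv_letter x) = x"
  by (cases x) (simp add: inv_letter_def)

lemma inv_letter_in [simp]: "inv_letter x \<in> UNIV \<times> M \<longleftrightarrow> x \<in> UNIV \<times> M"
  by (cases x) (simp add: inv_letter_def)

lemma reduced_Nil [simp]: "reduced []"
  by (simp add: reduced_def)

lemma reduced_Cons: "reduced (x # w) \<longleftrightarrow> reduced w \<and> (w = [] \<or> hd w \<noteq> inv_letter x)"
  by (cases w) (auto simp: reduced_def)

lemma reduced_push: "reduced w \<Longrightarrow> reduced (push x w)"
  by (cases w) (auto simp: reduced_Cons)

lemma reduced_foldr_push: "reduced w \<Longrightarrow> reduced (foldr push u w)"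
  by (induction u) (auto simp: reduced_push)

lemma set_push: "set (push x w) \<subseteq> insert x (set w)"
  by (cases w) auto

lemma set_foldr_push: "set (foldr push u w) \<subseteq> set u \<union> set w"
  by (induction u) (use set_push in fastforce)+

lemma push_reduced: "reduced (x # w) \<Longrightarrow> push x w = x # w"
  by (cases w) (auto simp: reduced_Cons)

lemma push_push_inv: "reduced w \<Longrightarrow> push x (push (inv_letter x) w) = w"
  by (cases w) (auto simp: push_reduced)

lemma foldr_push_Nil: "reduced u \<Longrightarrow> foldr push u [] = u"
  by (induction u) (auto simp: push_reduced reduced_Cons)

lemma foldr_push_push:
  "reduced w \<Longrightarrow> foldr push (push x v) w = push x (foldr push v w)"
  by (cases v) (auto simp: push_push_inv reduced_foldr_push)

lemma foldr_push_assoc: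
  "reduced w \<Longrightarrow> foldr push (foldr push u v) w = foldr push u (foldr push v w)"
  by (induction u) (auto simp: foldr_push_push)

lemma foldr_push_inverse:
  "reduced w \<Longrightarrow> foldr push (rev (map inv_letter u)) (foldr push u w) = w"
proof (induction u arbitrary: w)
  case (Cons x u)
  have "push (inv_letter x) (push x (foldr push u w)) = foldr push u w"
    using push_push_inv [of "foldr push u w" "inv_letter x"] Cons.prems
    by (simp add: reduced_foldr_push)
  then show ?case
    using Cons by simp
qed simp

lemma group_free_group: "group (free_group M)"
proof (rule groupI)
  fix u v assume "u \<in> carrier (free_group M)" "v \<in> carrier (free_group M)"
  then show "u \<otimes>\<^bsub>free_group M\<^esub> v \<in> carrier (free_group M)"
    using set_foldr_push [of u v] by (auto simp: reduced_foldr_push)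
next
  fix u assume u: "u \<in> carrier (free_group M)"
  let ?v = "foldr push (rev (map inv_letter u)) []"
  have "inv_letter ` set u \<subseteq> UNIV \<times> M"
    using u by (auto simp: inv_letter_def)
  then have "set ?v \<subseteq> UNIV \<times> M"
    using set_foldr_push [of "rev (map inv_letter u)" "[]"] by simp
  moreover have "foldr push ?v u = []"
    using u foldr_push_inverse [of "[]" u] by (simp add: foldr_push_assoc foldr_push_Nil)
  ultimately show "\<exists>v\<in>carrier (free_group M). v \<otimes>\<^bsub>free_group M\<^esub> u = \<one>\<^bsub>free_group M\<^esub>"
    by (intro bexI [of _ ?v]) (simp_all add: reduced_foldr_push)
qed (auto simp: foldr_push_assoc)

lemma gen_in_carrier: "a \<in> M \<Longrightarrow> gen a \<in> carrier (free_group M)"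
  by (auto simp: gen_def reduced_Cons)

lemma inv_gen:
  assumes "a \<in> M"
  shows "inv\<^bsub>free_group M\<^esub> gen a = [(True, a)]"
proof -
  interpret group "free_group M" by (rule group_free_group)
  show ?thesis
    by (rule inv_equality) (use assms in \<open>auto simp: gen_def reduced_Cons inv_letter_def\<close>)
qed

text \<open>Evaluation of a word in a group, along a valuation of the generators.\<close>

definition eval_letter :: "('g, 'b) monoid_scheme \<Rightarrow> ('a \<Rightarrow> 'g) \<Rightarrow> bool \<times> 'a \<Rightarrow> 'g"
  where "eval_letter H f x = (if fst x then inv\<^bsub>H\<^esub> f (snd x) else f (snd x))"

definition eval_word :: "('g, 'b) monoid_scheme \<Rightarrow> ('a \<Rightarrow> 'g) \<Rightarrow> (bool \<times> 'a) list \<Rightarrow> 'g"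
  where "eval_word H f w = foldr (\<lambda>x g. eval_letter H f x \<otimes>\<^bsub>H\<^esub> g) w \<one>\<^bsub>H\<^esub>"

lemma free_group_hom_eqI:
  assumes H: "group H" and h: "h \<in> hom (free_group M) H" and k: "k \<in> hom (free_group M) H"
    and eq: "\<And>a. a \<in> M \<Longrightarrow> h (gen a) = k (gen a)"
    and w: "w \<in> carrier (free_group M)"
  shows "h w = k w"
proof -
  interpret F: group "free_group M" by (rule group_free_group)
  interpret h: group_hom "free_group M" H h
    using H h by (simp add: group_hom_def group_hom_axioms_def F.group_axioms)
  interpret k: group_hom "free_group M" H k
    using H k by (simp add: group_hom_def group_hom_axioms_def F.group_axioms)
  show ?thesis
    using w
  proof (induction w)
    case Nil
    show ?case
      using h.hom_one k.hom_one by simp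
  next
    case (Cons x w)
    obtain s a where x: "x = (s, a)" by (cases x)
    have a: "a \<in> M" and w: "w \<in> carrier (free_group M)"
      using Cons.prems by (auto simp: x reduced_Cons)
    have letter: "[x] \<in> carrier (free_group M)"
      using a by (auto simp: x reduced_Cons)
    have "h [x] = k [x]"
    proof (cases s)
      case True
      then have "[x] = inv\<^bsub>free_group M\<^esub> gen a"
        using inv_gen [OF a] x by simp
      then show ?thesis
        using gen_in_carrier [OF a] eq [OF a] h.hom_inv k.hom_inv by metis
    next
      case False
      then show ?thesis
        using eq [OF a] by (simp add: gen_def x)
    qed
    moreover have "x # w = [x] \<otimes>\<^bsub>free_group M\<^esub> w"
      using Cons.prems by (simp add: push_reduced)
    ultimately show ?case
      using Cons.IH [OF w] h.hom_mult [OF letter w] k.hom_mult [OF letter w] by metis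
  qed
qed

lemma eval_word_hom:
  assumes "group H" and f: "f \<in> M \<rightarrow> carrier H"
  shows "eval_word H f \<in> hom (free_group M) H"
    and "a \<in> M \<Longrightarrow> eval_word H f (gen a) = f a"
proof -
  interpret H: group H by fact
  have letter [simp]: "eval_letter H f x \<in> carrier H" if "x \<in> UNIV \<times> M" for x
    using f that by (auto simp: eval_letter_def)
  have closed [simp]: "eval_word H f w \<in> carrier H" if "set w \<subseteq> UNIV \<times> M" for w
    using that by (induction w) (auto simp: eval_word_def)
  have eval_Cons: "eval_word H f (x # w) = eval_letter H f x \<otimes>\<^bsub>H\<^esub> eval_word H f w" for x w
    by (simp add: eval_word_def)
  have inv_letter: "eval_letter H f (inv_letter x) = inv\<^bsub>H\<^esub> eval_letter H f x"
    if "x \<in> UNIV \<times> M" for x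
  proof -
    have "f (snd x) \<in> carrier H"
      using f that by auto
    then show ?thesis
      by (simp add: eval_letter_def inv_letter_def)
  qed
  have push: "eval_word H f (push x w) = eval_letter H f x \<otimes>\<^bsub>H\<^esub> eval_word H f w"
    if "x \<in> UNIV \<times> M" "set w \<subseteq> UNIV \<times> M" for x w
  proof (cases w)
    case (Cons y v)
    then show ?thesis
      using that letter [OF that(1)] closed [of v]
      by (auto simp: eval_Cons inv_letter H.m_assoc [symmetric])
  qed (simp add: eval_Cons)
  have "eval_word H f (foldr push u v) = eval_word H f u \<otimes>\<^bsub>H\<^esub> eval_word H f v"
    if "set u \<subseteq> UNIV \<times> M" "set v \<subseteq> UNIV \<times> M" for u v
    using that
  proof (induction u)
    case Nil
    then show ?case using closed [of v] by (simp add: eval_word_def [of _ _ "[]"])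
  next
    case (Cons x u)
    have "set (foldr push u v) \<subseteq> UNIV \<times> M"
      using set_foldr_push [of u v] Cons.prems by auto
    then show ?case
      using Cons letter [of x] closed [of u] closed [of v]
      by (simp add: push eval_Cons H.m_assoc)
  qed
  then show "eval_word H f \<in> hom (free_group M) H"
    by (auto simp: hom_def)
  show "eval_word H f (gen a) = f a" if "a \<in> M"
  proof -
    have "f a \<in> carrier H"
      using f that by auto
    then show ?thesis
      by (simp add: eval_word_def gen_def eval_letter_def)
  qed
qed

theorem free_group_universal:
  assumes "group H" and "f \<in> M \<rightarrow> carrier H"
  shows "\<exists>!h. h \<in> extensional (carrier (free_group M)) \<and>
           h \<in> hom (free_group M) H \<and> (\<forall>a\<in>M. h (gen a) = f a)"
proof (rule ex1I)
  interpret F: group "free_group M" by (rule group_free_group)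
  let ?h = "restrict (eval_word H f) (carrier (free_group M))"
  have "?h \<in> hom (free_group M) H"
    using eval_word_hom(1) [OF assms] by (rule F.hom_restrict) simp
  then show "?h \<in> extensional (carrier (free_group M)) \<and>
      ?h \<in> hom (free_group M) H \<and> (\<forall>a\<in>M. ?h (gen a) = f a)"
    using eval_word_hom(2) [OF assms] by (simp add: gen_in_carrier del: free_group_simps)
  fix k
  assume k: "k \<in> extensional (carrier (free_group M)) \<and>
      k \<in> hom (free_group M) H \<and> (\<forall>a\<in>M. k (gen a) = f a)"
  show "k = ?h"
  proof (rule extensionalityI)
    fix w assume "w \<in> carrier (free_group M)"
    then show "k w = ?h w"
      using free_group_hom_eqI [OF assms(1), of k M "eval_word H f"] k eval_word_hom [OF assms]
      by auto
  qed (use k in auto)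
qed

end

theory Submission
  imports Defs "HOL-Algebra.Coset"
begin

text \<open>
  For a letter \<open>x\<close> of \<open>M \<union> M\<inverse>\<close>, the map \<open>x \<rhd> -\<close> acts on words letterwise, by a sign-preserving
  permutation of the letters; this uses that the \<open>*\<close>-inverse of a generator \<open>m\<close> is the letter
  \<open>(Lam m)\<inverse>\<close>.  Hence \<open>\<J>\<close>, the extension of \<open>gen\<close> to a homomorphism into the Grossman--Larson
  group, sends the letters bijectively to letters, by a map \<open>\<phi>\<close> say.  In
  \<open>\<J> (x\<^sub>1 \<dots> x\<^sub>n) = \<phi> x\<^sub>1 . (\<phi> x\<^sub>1 \<rhd> \<J> (x\<^sub>2 \<dots> x\<^sub>n))\<close> a cancellation would mean
  \<open>\<phi> x\<^sub>1 * \<phi> x\<^sub>2 = 1\<close>, hence \<open>x\<^sub>2 = x\<^sub>1\<inverse>\<close>.  So \<open>\<J>\<close> preserves the length of reduced words, and is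
  therefore injective.  Splitting off the first letter, \<open>x . w = x * (x \<rhd> -)\<inverse> w\<close>, shows by
  induction on the length that it is surjective.
\<close>

section \<open>Letterwise maps on the free group\<close>

lemma inv_letter_map_prod: "inv_letter (map_prod id p x) = map_prod id p (inv_letter x)"
  by (cases x) (simp add: inv_letter_def)

lemma map_prod_letter_in: "bij_betw p M M \<Longrightarrow> x \<in> UNIV \<times> M \<Longrightarrow> map_prod id p x \<in> UNIV \<times> M"
  by (auto simp: bij_betw_def)

text \<open>The map commutes with \<open>inv_letter\<close> and is injective on letters, so no new
  cancelling pair can arise.\<close>

lemma reduced_map_letters:
  assumes "bij_betw p M M" "reduced w" "set w \<subseteq> UNIV \<times> M"
  shows "reduced (map (map_prod id p) w)"
  using assms(2,3)
proof (induction w)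
  case (Cons x w)
  show ?case
  proof (cases w)
    case (Cons y v)
    have "inj_on (map_prod id p) (UNIV \<times> M)"
      using assms(1) by (auto simp: bij_betw_def inj_on_def)
    moreover have "y \<in> UNIV \<times> M" "inv_letter x \<in> UNIV \<times> M" "y \<noteq> inv_letter x"
      using Cons.prems \<open>w = y # v\<close> by (auto simp: reduced_Cons)
    ultimately have "map_prod id p y \<noteq> inv_letter (map_prod id p x)"
      by (metis inj_onD inv_letter_map_prod)
    then show ?thesis
      using Cons.IH Cons.prems \<open>w = y # v\<close> by (auto simp: reduced_Cons)
  qed (simp add: reduced_Cons)
qed simp

lemma map_letters_in_carrier:
  assumes "bij_betw p M M" "w \<in> carrier (free_group M)"
  shows "map (map_prod id p) w \<in> carrier (free_group M)"
  using assms reduced_map_letters [OF assms(1)] map_prod_letter_in [OF assms(1)] by fastforce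

lemma map_letters_hom:
  assumes "bij_betw p M M"
  shows "map (map_prod id p) \<in> hom (free_group M) (free_group M)"
proof (rule homI)
  fix u v assume u: "u \<in> carrier (free_group M)" and v: "v \<in> carrier (free_group M)"
  have inj: "inj_on (map_prod id p) (UNIV \<times> M)"
    using assms by (auto simp: bij_betw_def inj_on_def)
  have push: "map (map_prod id p) (push x w) = push (map_prod id p x) (map (map_prod id p) w)"
    if "x \<in> UNIV \<times> M" "set w \<subseteq> UNIV \<times> M" for x w
  proof (cases w)
    case (Cons y v)
    then have "map_prod id p y = inv_letter (map_prod id p x) \<longleftrightarrow> y = inv_letter x"
      using that inj_on_eq_iff [OF inj, of y "inv_letter x"] by (simp add: inv_letter_map_prod)
    then show ?thesis
      using Cons by simp
  qed simp
  have "map (map_prod id p) (foldr push u v) =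
      foldr push (map (map_prod id p) u) (map (map_prod id p) v)"
    if "set u \<subseteq> UNIV \<times> M" for u
    using that
  proof (induction u)
    case (Cons x u)
    have "set (foldr push u v) \<subseteq> UNIV \<times> M"
      using set_foldr_push [of u v] Cons.prems v by auto
    then show ?case
      using Cons.IH Cons.prems push [of x "foldr push u v"]
      by (simp only: foldr.simps comp_apply list.map list.set insert_subset)
  qed simp
  then show "map (map_prod id p) (u \<otimes>\<^bsub>free_group M\<^esub> v) =
      map (map_prod id p) u \<otimes>\<^bsub>free_group M\<^esub> map (map_prod id p) v"
    using u by simp
qed (use map_letters_in_carrier [OF assms] in blast)

text \<open>Both sides are homomorphisms, so agreement on the generators suffices.\<close>

lemma free_group_endo_eq_map:
  assumes "h \<in> hom (free_group M) (free_group M)" "bij_betw p M M"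
    and "\<And>n. n \<in> M \<Longrightarrow> h (gen n) = gen (p n)" "w \<in> carrier (free_group M)"
  shows "h w = map (map_prod id p) w"
  by (rule free_group_hom_eqI [OF group_free_group assms(1) map_letters_hom [OF assms(2)] _ assms(4)])
     (use assms(3) in \<open>simp add: gen_def\<close>)

lemma letter_in_carrier: "x \<in> UNIV \<times> M \<Longrightarrow> [x] \<in> carrier (free_group M)"
  by (simp add: reduced_Cons)

section \<open>The action of single letters\<close>

locale free_post_group =
  diagonal_left_regular_magma M tri + post_group "free_group M" ftri
  for M :: "'a set" and tri and ftri +
  assumes ftri_gen: "\<lbrakk>m \<in> M; n \<in> M\<rbrakk> \<Longrightarrow> ftri (gen m) (gen n) = gen (tri m n)"
begin

abbreviation GL where "GL \<equiv> grossman_larson (free_group M) ftri"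

sublocale GL: group GL
  by (rule group_grossman_larson)

lemma ftri_hom: "a \<in> carrier (free_group M) \<Longrightarrow> ftri a \<in> hom (free_group M) (free_group M)"
  using left_mult_aut [of a] by (simp add: iso_def)

lemma ftri_gen_eq_map:
  assumes "m \<in> M" "w \<in> carrier (free_group M)"
  shows "ftri (gen m) w = map (map_prod id (tri m)) w"
  using free_group_endo_eq_map [OF ftri_hom [OF gen_in_carrier] left_mult_bij ftri_gen] assms by metis

lemma Lam_in: "m \<in> M \<Longrightarrow> Lam m \<in> M"
  using Lam_bij by (auto simp: bij_betw_def)

lemma tri_Lam: "m \<in> M \<Longrightarrow> tri m (Lam m) = m"
  using left_mult_bij [of m] unfolding Lam_def by (simp add: bij_betw_def f_inv_into_f)

text \<open>Since \<open>tri m (Lam m) = m\<close>, the generator \<open>m\<close> moves the letter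
  inverse to \<open>Lam m\<close> to the letter inverse to \<open>m\<close>, which cancels against
  \<open>gen m\<close>.\<close>

lemma GL_inv_gen:
  assumes "m \<in> M"
  shows "inv\<^bsub>GL\<^esub> gen m = [(True, Lam m)]"
proof -
  have letter: "[(True, Lam m)] \<in> carrier (free_group M)"
    using Lam_in [OF assms] by (intro letter_in_carrier) simp
  have "gen m \<otimes>\<^bsub>GL\<^esub> [(True, Lam m)] = \<one>\<^bsub>GL\<^esub>"
    using ftri_gen_eq_map [OF assms letter] tri_Lam [OF assms] by (simp add: gen_def inv_letter_def)
  moreover have "gen m \<in> carrier GL" "[(True, Lam m)] \<in> carrier GL"
    using gen_in_carrier [OF assms] letter by (simp_all del: free_group_simps)
  ultimately show ?thesis
    by (metis GL.inv_equality GL.inv_inv)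
qed

text \<open>By \<open>weighted_assoc\<close>, the \<open>GL\<close>-inverse of \<open>gen m\<close>
  acts by the inverse of the action of \<open>gen m\<close>, hence again permutes the
  generators.\<close>

lemma ftri_inverse_gen_eq_map:
  assumes m: "m \<in> M" and w: "w \<in> carrier (free_group M)"
  shows "ftri [(True, Lam m)] w = map (map_prod id (inv_into M (tri m))) w"
proof (rule free_group_endo_eq_map [OF ftri_hom _ _ w])
  have bij: "bij_betw (tri m) M M"
    using left_mult_bij [OF m] by simp
  show letter: "[(True, Lam m)] \<in> carrier (free_group M)"
    using Lam_in [OF m] by (intro letter_in_carrier) simp
  show "bij_betw (inv_into M (tri m)) M M"
    by (rule bij_betw_inv_into [OF bij])
  fix n assume n: "n \<in> M"
  define k where "k = inv_into M (tri m) n"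
  have k: "k \<in> M" "tri m k = n"
    using bij n unfolding k_def by (auto simp: bij_betw_def f_inv_into_f inv_into_into)
  have "[(True, Lam m)] \<otimes>\<^bsub>GL\<^esub> gen m = \<one>\<^bsub>GL\<^esub>"
    using GL.l_inv [of "gen m"] GL_inv_gen [OF m] gen_in_carrier [OF m] by (simp del: free_group_simps)
  then have "ftri [(True, Lam m)] (ftri (gen m) (gen k)) = ftri \<one>\<^bsub>free_group M\<^esub> (gen k)"
    using weighted_assoc [OF letter gen_in_carrier [OF m] gen_in_carrier [OF k(1)]]
    by (simp del: free_group_simps)
  then show "ftri [(True, Lam m)] (gen n) = gen (inv_into M (tri m) n)"
    using ftri_gen [OF m k(1)] one_tri [OF gen_in_carrier [OF k(1)]] k(2)
    by (simp add: k_def del: free_group_simps)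
qed

lemma ftri_letter_eq_map:
  assumes "x \<in> UNIV \<times> M"
  obtains p where "bij_betw p M M"
    and "\<And>w. w \<in> carrier (free_group M) \<Longrightarrow> ftri [x] w = map (map_prod id p) w"
proof (cases "fst x")
  case False
  then have x: "[x] = gen (snd x)" "snd x \<in> M"
    using assms by (auto simp: gen_def prod_eq_iff)
  then show thesis
    using that [OF left_mult_bij] ftri_gen_eq_map by simp
next
  case True
  then have "x = (True, snd x)" "snd x \<in> M"
    using assms by (auto simp: prod_eq_iff)
  \<comment> \<open>Surjectivity of \<open>Lam\<close> makes every inverse letter the
    \<open>GL\<close>-inverse of a generator.\<close>
  moreover obtain m where "m \<in> M" "snd x = Lam m"
    using Lam_bij \<open>snd x \<in> M\<close> unfolding bij_betw_def by (metis imageE)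
  ultimately show thesis
    using that [OF bij_betw_inv_into [OF left_mult_bij]] ftri_inverse_gen_eq_map by metis
qed

section \<open>The homomorphism \<open>J\<close> and its effect on letters\<close>

definition phi :: "bool \<times> 'a \<Rightarrow> bool \<times> 'a"
  where "phi x = (if fst x then (True, Lam (snd x)) else x)"

text \<open>Signs are kept, so this reduces to the bijectivity of \<open>Lam\<close> on the inverse
  letters.\<close>

lemma phi_bij: "bij_betw phi (UNIV \<times> M) (UNIV \<times> M)"
proof (rule bij_betw_imageI)
  show "inj_on phi (UNIV \<times> M)"
    using Lam_bij by (auto simp: inj_on_def phi_def bij_betw_def)
  have "y \<in> phi ` (UNIV \<times> M)" if y: "y \<in> UNIV \<times> M" for y
  proof (cases "fst y")
    case True
    obtain m where "m \<in> M" "snd y = Lam m"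
      using Lam_bij y unfolding bij_betw_def by (metis SigmaE imageE snd_conv)
    with True show ?thesis
      by (intro image_eqI [of _ _ "(True, m)"]) (auto simp: phi_def prod_eq_iff)
  next
    case False
    with y show ?thesis
      by (intro image_eqI [of _ _ y]) (auto simp: phi_def)
  qed
  then show "phi ` (UNIV \<times> M) = UNIV \<times> M"
    by (auto simp: phi_def Lam_in)
qed

lemma phi_in: "x \<in> UNIV \<times> M \<Longrightarrow> phi x \<in> UNIV \<times> M"
  using phi_bij by (auto simp: bij_betw_def)

definition J :: "(bool \<times> 'a) list \<Rightarrow> (bool \<times> 'a) list"
  where "J = eval_word GL gen"

lemma gen_GL: "gen \<in> M \<rightarrow> carrier GL"
  using gen_in_carrier by (auto simp del: free_group_simps)

lemma J_hom: "J \<in> hom (free_group M) GL"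
  and J_gen: "m \<in> M \<Longrightarrow> J (gen m) = gen m"
  unfolding J_def using eval_word_hom [OF GL.group_axioms gen_GL] by auto

sublocale J: group_hom "free_group M" GL J
  by unfold_locales (rule J_hom)

lemma J_Nil: "J [] = []"
  using J.hom_one by simp

lemma J_Cons:
  assumes "x \<in> UNIV \<times> M"
  shows "J (x # w) = [phi x] \<otimes>\<^bsub>GL\<^esub> J w"
proof -
  have "eval_letter GL gen x = [phi x]"
    using assms GL_inv_gen [of "snd x"]
    by (cases x) (auto simp: eval_letter_def phi_def gen_def)
  then show ?thesis
    by (simp add: J_def eval_word_def)
qed

lemma J_letter:
  assumes "x \<in> UNIV \<times> M"
  shows "J [x] = [phi x]"
  using J_Cons [OF assms, of "[]"] J.hom_one GL.r_one [of "[phi x]"]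
    letter_in_carrier [OF phi_in [OF assms]]
  by (metis free_group_simps(3) grossman_larson_simps(1))

text \<open>As \<open>J\<close> is a homomorphism, \<open>[phi (inv_letter x)]\<close> is also a
  right \<open>GL\<close>-inverse of \<open>[phi x]\<close>; cancellation in \<open>GL\<close> and
  injectivity of \<open>phi\<close> conclude.\<close>

lemma phi_mult_eq_one_imp:
  assumes x: "x \<in> UNIV \<times> M" and y: "y \<in> UNIV \<times> M" and eq: "[phi x] \<otimes>\<^bsub>GL\<^esub> [phi y] = \<one>\<^bsub>GL\<^esub>"
  shows "y = inv_letter x"
proof -
  have x': "inv_letter x \<in> UNIV \<times> M"
    using x by simp
  have closed: "[phi x] \<in> carrier GL" "[phi y] \<in> carrier GL" "[phi (inv_letter x)] \<in> carrier GL"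
    using letter_in_carrier phi_in x y x' by (metis grossman_larson_simps(1))+
  have "[phi x] \<otimes>\<^bsub>GL\<^esub> [phi (inv_letter x)] = J ([x] \<otimes>\<^bsub>free_group M\<^esub> [inv_letter x])"
    using J.hom_mult [OF letter_in_carrier [OF x] letter_in_carrier [OF x']]
      J_letter [OF x] J_letter [OF x'] by metis
  also have "\<dots> = \<one>\<^bsub>GL\<^esub>"
    by (simp add: J_Nil)
  finally have "[phi x] \<otimes>\<^bsub>GL\<^esub> [phi (inv_letter x)] = [phi x] \<otimes>\<^bsub>GL\<^esub> [phi y]"
    using eq by (simp only:)
  then have "[phi (inv_letter x)] = [phi y]"
    using GL.Units_l_cancel [of "[phi x]"] closed unfolding GL.Units_eq by blast
  then show ?thesis
    using phi_bij x' y by (auto simp: bij_betw_def dest: inj_onD)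
qed

section \<open>Bijectivity of \<open>J\<close>\<close>

lemma J_length_hd:
  assumes "w \<in> carrier (free_group M)"
  shows "length (J w) = length w \<and> (w \<noteq> [] \<longrightarrow> hd (J w) = phi (hd w))"
  using assms
proof (induction w)
  case Nil
  show ?case by (simp add: J_Nil)
next
  case (Cons x w)
  have x: "x \<in> UNIV \<times> M" and w: "w \<in> carrier (free_group M)"
    using Cons.prems by (auto simp: reduced_Cons)
  show ?case
  proof (cases w)
    case Nil
    then show ?thesis
      using J_letter [OF x] by simp
  next
    case w_eq: (Cons y v)
    have y: "y \<in> UNIV \<times> M" and "y \<noteq> inv_letter x"
      using Cons.prems w_eq by (auto simp: reduced_Cons)
    \<comment> \<open>The claim on the head serves here: the first letter of \<open>J w\<close>
      decides whether prepending cancels.\<close>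
    obtain t where t: "J w = phi y # t" "length t = length v"
      using Cons.IH [OF w] w_eq by (cases "J w") auto
    obtain p where p: "\<And>u. u \<in> carrier (free_group M) \<Longrightarrow> ftri [phi x] u = map (map_prod id p) u"
      using ftri_letter_eq_map [OF phi_in [OF x]] by metis
    have "J w \<in> carrier (free_group M)"
      using J.hom_closed [OF w] by simp
    then have "J (x # w) = push (phi x) (map_prod id p (phi y) # map (map_prod id p) t)"
      using J_Cons [OF x, of w] p [of "J w"] t by simp
    \<comment> \<open>If \<open>push\<close> cancelled here, the two letters \<open>phi x\<close>
      and \<open>phi y\<close> alone would have \<open>GL\<close>-product one, against the
      reducedness of \<open>x # w\<close>.\<close>
    moreover have "map_prod id p (phi y) \<noteq> inv_letter (phi x)"
    proof
      assume "map_prod id p (phi y) = inv_letter (phi x)"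
      then have "[phi x] \<otimes>\<^bsub>GL\<^esub> [phi y] = \<one>\<^bsub>GL\<^esub>"
        using p [OF letter_in_carrier [OF phi_in [OF y]]] by simp
      then show False
        using phi_mult_eq_one_imp [OF x y] \<open>y \<noteq> inv_letter x\<close> by simp
    qed
    ultimately show ?thesis
      using t w_eq by simp
  qed
qed

lemma J_surj:
  assumes "w \<in> carrier (free_group M)"
  shows "w \<in> J ` carrier (free_group M)"
  using assms
proof (induction "length w" arbitrary: w)
  case 0
  then show ?case
    using J_Nil by (intro image_eqI [of _ _ "[]"]) auto
next
  case (Suc k)
  then obtain x v where w_eq: "w = x # v" "length v = k"
    by (cases w) auto
  have x: "x \<in> UNIV \<times> M" and v: "v \<in> carrier (free_group M)"
    using Suc.prems w_eq by (auto simp: reduced_Cons)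
  obtain p where p: "\<And>u. u \<in> carrier (free_group M) \<Longrightarrow> ftri [x] u = map (map_prod id p) u"
    using ftri_letter_eq_map [OF x] by metis
  \<comment> \<open>Undoing the action of \<open>x\<close> on the tail turns the free product into a
    \<open>GL\<close>-product: \<open>x . v = x . (x \<rhd> u) = x * u\<close>. The action is
    letterwise, so \<open>u\<close> is as long as \<open>v\<close> and the induction hypothesis
    applies.\<close>
  obtain u where u: "u \<in> carrier (free_group M)" "ftri [x] u = v"
    using tri_bij [OF letter_in_carrier [OF x]] v unfolding bij_betw_def by (metis imageE)
  then have "length u = k"
    using p [of u] w_eq by auto
  then obtain u' where u': "u' \<in> carrier (free_group M)" "u = J u'"
    using Suc.hyps(1) u(1) by blast
  obtain y where y: "y \<in> UNIV \<times> M" "x = phi y"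
    using phi_bij x unfolding bij_betw_def by (metis imageE)
  have "J ([y] \<otimes>\<^bsub>free_group M\<^esub> u') = [x] \<otimes>\<^bsub>GL\<^esub> u"
    using J.hom_mult [OF letter_in_carrier [OF y(1)] u'(1)] J_letter [OF y(1)] y(2) u'(2) by metis
  also have "\<dots> = w"
    using u(2) w_eq Suc.prems by (simp add: push_reduced)
  finally show ?case
    using m_closed [OF letter_in_carrier [OF y(1)] u'(1)] by (metis imageI)
qed

lemma J_iso: "J \<in> iso (free_group M) GL"
proof -
  \<comment> \<open>Preservation of length makes the kernel trivial.\<close>
  have "w = []" if "w \<in> carrier (free_group M)" "J w = []" for w
    using J_length_hd [OF that(1)] that(2) by simp
  moreover have "carrier GL \<subseteq> J ` carrier (free_group M)"
    using J_surj by (auto simp del: free_group_simps)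
  ultimately show ?thesis
    unfolding J.iso_iff by simp
qed

end

theorem proposition14:
  fixes M :: "'a set" and tri :: "'a \<Rightarrow> 'a \<Rightarrow> 'a"
    and ftri :: "(bool \<times> 'a) list \<Rightarrow> (bool \<times> 'a) list \<Rightarrow> (bool \<times> 'a) list"
  assumes "diagonal_left_regular_magma M tri"
    and "post_group (free_group M) ftri"
    and "\<And>m n. m \<in> M \<Longrightarrow> n \<in> M \<Longrightarrow> ftri (gen m) (gen n) = gen (tri m n)"
  shows "\<exists>!J. J \<in> extensional (carrier (free_group M)) \<and>
           J \<in> iso (free_group M) (grossman_larson (free_group M) ftri) \<and>
           (\<forall>m\<in>M. J (gen m) = gen m)"
proof (rule ex_ex1I)
  interpret free_post_group M tri ftri
    using assms by (intro free_post_group.intro free_post_group_axioms.intro)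
  \<comment> \<open>Values off the carrier are arbitrary for \<open>iso\<close>; the restriction is
    the extensional representative, which makes uniqueness as a function possible.\<close>
  let ?J = "restrict J (carrier (free_group M))"
  have "?J \<in> iso (free_group M) GL"
    using J_iso bij_betw_restrict_eq hom_restrict [OF J_hom, of ?J]
    by (simp add: iso_def del: free_group_simps)
  moreover have "?J (gen m) = gen m" if "m \<in> M" for m
    using J_gen gen_in_carrier that by (metis restrict_apply')
  ultimately show "\<exists>J. J \<in> extensional (carrier (free_group M)) \<and> J \<in> iso (free_group M) GL \<and>
      (\<forall>m\<in>M. J (gen m) = gen m)"
    using restrict_extensional by blast
next
  let ?GL = "grossman_larson (free_group M) ftri"
  fix J K
  assume J: "J \<in> extensional (carrier (free_group M)) \<and> J \<in> iso (free_group M) ?GL \<and>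
      (\<forall>m\<in>M. J (gen m) = gen m)"
    and K: "K \<in> extensional (carrier (free_group M)) \<and> K \<in> iso (free_group M) ?GL \<and>
      (\<forall>m\<in>M. K (gen m) = gen m)"
  then have hom: "J \<in> hom (free_group M) ?GL" "K \<in> hom (free_group M) ?GL"
    by (simp_all add: iso_def)
  \<comment> \<open>Agreement on generators passes to the carrier, and extensionality fixes the
    values elsewhere.\<close>
  have "J (gen m) = K (gen m)" if "m \<in> M" for m
    using J K that by metis
  then have "J w = K w" if "w \<in> carrier (free_group M)" for w
    using free_group_hom_eqI [OF post_group.group_grossman_larson [OF assms(2)] hom] that by blast
  then show "J = K"
    using J K extensionalityI by blast
qed

end
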